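(* Let $X$ and $Y$ be Tychonoff spaces, and let $D_p(Y)$ be either $C_p(Y)$ or $C_p^*(Y)$. Suppose that $\varphi: C_p^*(X)\to D_p(Y)$ is a bounded uniform homeomorphism. If $X$ is pseudocompact, then $Y$ is pseudocompact.
   Context: For a Tychonoff space $X$, $C_p(X)$ is the space of all continuous real-valued functions on $X$ with the topology of pointwise convergence, and $C_p^*(X)$ is its subspace consisting of the bounded functions. These spaces carry the uniform structure of pointwise convergence (as subspaces of $\mathbb R^X$). $D_p(X)$ denotes either $C_p(X)$ or $C_p^*(X)$ (and likewise $D_p(Y)$; the choices for $X$ and $Y$ are independent). A uniform homeomorphism is a bijection that is uniformly continuous together with its inverse. A space is pseudocompact if every continuous real-valued function on it is bounded. For a uniformly continuous surjection $\varphi:D_p(X)\to D_p(Y)$, $y\in Y$ and $K\subset X$ put $$a_\varphi(y,K)=\sup\{|\varphi(f)(y)-\varphi(g)(y)|: f,g\in D_p(X)\text{ and } |f(x)-g(x)|<1\ \ \forall x\in K\}\in[0,\infty].$$ The map $\varphi$ is called bounded if there is $m\in\mathbb N$ such that for every $y\in Y$ there is a finite set $K\subset X$ with $a_\varphi(y,K)\leq m$. *)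

theory Defs
  imports "HOL-Analysis.Analysis"
begin

definition tychonoff_space :: "'a topology \<Rightarrow> bool" where
  "tychonoff_space X \<longleftrightarrow> completely_regular_space X \<and> Hausdorff_space X"

definition pseudocompact_space :: "'a topology \<Rightarrow> bool" where
  "pseudocompact_space X \<longleftrightarrow>
     (\<forall>f. continuous_map X euclideanreal f \<longrightarrow> bounded (f ` topspace X))"

text \<open>
  A real-valued function on a space \<open>X\<close> is represented by the total function that is
  \<open>undefined\<close> outside \<open>topspace X\<close>, so that equality is equality on the points of \<open>X\<close>.
\<close>

definition Cp :: "'a topology \<Rightarrow> ('a \<Rightarrow> real) set" where
  "Cp X = {f \<in> extensional (topspace X). continuous_map X euclideanreal f}"

definition Cp_star :: "'a topology \<Rightarrow> ('a \<Rightarrow> real) set" where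
  "Cp_star X = {f \<in> Cp X. bounded (f ` topspace X)}"

text \<open>
  The uniformity of pointwise convergence on a set \<open>D\<close> of real functions on \<open>S\<close>: the trace on
  \<open>D \<times> D\<close> of the product uniformity, i.e. of the coarsest uniformity making all
  evaluations at points of \<open>S\<close> uniformly continuous.
\<close>

definition pointwise_uniformity ::
  "'a set \<Rightarrow> ('a \<Rightarrow> real) set \<Rightarrow> (('a \<Rightarrow> real) \<times> ('a \<Rightarrow> real)) filter" where
  "pointwise_uniformity S D =
     inf (INF x\<in>S. filtercomap (\<lambda>(f, g). (f x, g x)) uniformity) (principal (D \<times> D))"

definition uniformly_continuous_p ::
  "'a set \<Rightarrow> ('a \<Rightarrow> real) set \<Rightarrow> 'b set \<Rightarrow> ('b \<Rightarrow> real) set \<Rightarrow>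
   (('a \<Rightarrow> real) \<Rightarrow> ('b \<Rightarrow> real)) \<Rightarrow> bool" where
  "uniformly_continuous_p S D T E \<phi> \<longleftrightarrow>
     \<phi> \<in> D \<rightarrow> E \<and>
     filterlim (\<lambda>(f, g). (\<phi> f, \<phi> g)) (pointwise_uniformity T E) (pointwise_uniformity S D)"

definition uniform_homeomorphism_p ::
  "'a set \<Rightarrow> ('a \<Rightarrow> real) set \<Rightarrow> 'b set \<Rightarrow> ('b \<Rightarrow> real) set \<Rightarrow>
   (('a \<Rightarrow> real) \<Rightarrow> ('b \<Rightarrow> real)) \<Rightarrow> bool" where
  "uniform_homeomorphism_p S D T E \<phi> \<longleftrightarrow>
     bij_betw \<phi> D E \<and>
     uniformly_continuous_p S D T E \<phi> \<and>
     uniformly_continuous_p T E S D (inv_into D \<phi>)"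

definition a_map ::
  "('a \<Rightarrow> real) set \<Rightarrow> (('a \<Rightarrow> real) \<Rightarrow> ('b \<Rightarrow> real)) \<Rightarrow> 'b \<Rightarrow> 'a set \<Rightarrow> ennreal" where
  "a_map D \<phi> y K =
     (SUP (f, g) \<in> {(f, g). f \<in> D \<and> g \<in> D \<and> (\<forall>x\<in>K. \<bar>f x - g x\<bar> < 1)}.
        ennreal \<bar>\<phi> f y - \<phi> g y\<bar>)"

definition bounded_map ::
  "'a set \<Rightarrow> ('a \<Rightarrow> real) set \<Rightarrow> 'b set \<Rightarrow> (('a \<Rightarrow> real) \<Rightarrow> ('b \<Rightarrow> real)) \<Rightarrow> bool" where
  "bounded_map S D T \<phi> \<longleftrightarrow>
     (\<exists>m::nat. \<forall>y\<in>T. \<exists>K. finite K \<and> K \<subseteq> S \<and> a_map D \<phi> y K \<le> of_nat m)"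

lemma eventually_pointwise_uniformity:
  "eventually P (pointwise_uniformity S D) \<longleftrightarrow>
     (\<exists>K \<delta>. finite K \<and> K \<subseteq> S \<and> 0 < \<delta> \<and>
        (\<forall>f\<in>D. \<forall>g\<in>D. (\<forall>x\<in>K. \<bar>f x - g x\<bar> < \<delta>) \<longrightarrow> P (f, g)))"
  (is "?L = ?R")
proof
  let ?F = "\<lambda>x. filtercomap (\<lambda>(f::'a \<Rightarrow> real, g). (f x, g x)) uniformity"
  have ev: "eventually Q (?F x) \<longleftrightarrow>
      (\<exists>\<delta>>0. \<forall>f g. \<bar>f x - g x\<bar> < \<delta> \<longrightarrow> Q (f, g))" for Q x
  proof
    assume "eventually Q (?F x)"
    then obtain R where R: "eventually R uniformity" "\<And>f g. R (f x, g x) \<Longrightarrow> Q (f, g)"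
      by (auto simp: eventually_filtercomap)
    then show "\<exists>\<delta>>0. \<forall>f g. \<bar>f x - g x\<bar> < \<delta> \<longrightarrow> Q (f, g)"
      unfolding eventually_uniformity_metric dist_real_def by meson
  next
    assume "\<exists>\<delta>>0. \<forall>f g. \<bar>f x - g x\<bar> < \<delta> \<longrightarrow> Q (f, g)"
    then obtain \<delta> where "\<delta> > 0" and Q: "\<And>f g. \<bar>f x - g x\<bar> < \<delta> \<Longrightarrow> Q (f, g)" by blast
    then have "eventually (\<lambda>(a::real, b). \<bar>a - b\<bar> < \<delta>) uniformity"
      unfolding eventually_uniformity_metric dist_real_def by auto
    then show "eventually Q (?F x)"
      unfolding eventually_filtercomap using Q by (intro exI conjI) auto
  qed
  {
    assume ?L
    then have "eventually (\<lambda>p. p \<in> D \<times> D \<longrightarrow> P p) (INF x\<in>S. ?F x)"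
      by (simp add: pointwise_uniformity_def eventually_inf_principal)
    then obtain K where K: "K \<subseteq> S" "finite K"
      "eventually (\<lambda>p. p \<in> D \<times> D \<longrightarrow> P p) (INF x\<in>K. ?F x)"
      by (subst (asm) eventually_INF) (elim bexE exE conjE, simp)
    from eventually_INF_finite[OF K(2), THEN iffD1, OF K(3)] obtain Q
      where Q: "\<forall>x\<in>K. eventually (Q x) (?F x)"
        "\<forall>p. (\<forall>x\<in>K. Q x p) \<longrightarrow> p \<in> D \<times> D \<longrightarrow> P p"
      by (elim exE conjE) (rule that)
    from Q(1) have "\<forall>x\<in>K. \<exists>\<delta>>0. \<forall>f g. \<bar>f x - g x\<bar> < \<delta> \<longrightarrow> Q x (f, g)"
      by (simp only: ev ball_simps)
    then obtain d where d: "\<And>x. x \<in> K \<Longrightarrow> d x > 0"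
      "\<And>x f g. x \<in> K \<Longrightarrow> \<bar>f x - g x\<bar> < d x \<Longrightarrow> Q x (f, g)"
      unfolding bchoice_iff by blast
    define \<delta> where "\<delta> = Min (insert 1 (d ` K))"
    have "\<delta> > 0" "\<And>x. x \<in> K \<Longrightarrow> \<delta> \<le> d x"
      using K(2) d(1) by (auto simp: \<delta>_def)
    moreover from this have "P (f, g)"
      if "f \<in> D" "g \<in> D" "\<forall>x\<in>K. \<bar>f x - g x\<bar> < \<delta>" for f g
    proof -
      have "Q x (f, g)" if "x \<in> K" for x
        using d(2)[OF that] \<open>\<forall>x\<in>K. \<bar>f x - g x\<bar> < \<delta>\<close> that
          \<open>\<And>x. x \<in> K \<Longrightarrow> \<delta> \<le> d x\<close> by (meson less_le_trans)
      then show ?thesis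
        using Q(2)[rule_format, of "(f, g)"] that(1,2) by simp
    qed
    ultimately show ?R using K by blast
  next
    assume ?R
    then obtain K \<delta> where K: "finite K" "K \<subseteq> S" "0 < \<delta>"
      "\<And>f g. f \<in> D \<Longrightarrow> g \<in> D \<Longrightarrow> \<forall>x\<in>K. \<bar>f x - g x\<bar> < \<delta> \<Longrightarrow> P (f, g)" by blast
    have "eventually (\<lambda>p. \<bar>fst p x - snd p x\<bar> < \<delta>) (?F x)" for x
      unfolding ev using K(3) by auto
    moreover have "(INF x\<in>S. ?F x) \<le> ?F x" if "x \<in> K" for x
      using that K(2) by (intro INF_lower) auto
    ultimately have "eventually (\<lambda>p. \<bar>fst p x - snd p x\<bar> < \<delta>) (INF x\<in>S. ?F x)"
      if "x \<in> K" for x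
      using that filter_leD by blast
    then have "eventually (\<lambda>p. \<forall>x\<in>K. \<bar>fst p x - snd p x\<bar> < \<delta>) (INF x\<in>S. ?F x)"
      using K(1) by (simp add: eventually_ball_finite)
    then show ?L
      unfolding pointwise_uniformity_def eventually_inf_principal
      by eventually_elim (use K(4) in auto)
  }
qed

end

theory Submission
  imports Defs "HOL-Library.Nat_Bijection"
begin

text \<open>
  If \<open>Y\<close> carries an unbounded continuous function, then composing it with suitable bounded
  functions on the line gives continuous bounded functions \<open>h A\<close>, one for each set \<open>A\<close> of natural
  numbers, such that two distinct ones differ by \<open>m + 1\<close> at some point, while the value of
  \<open>h A\<close> at any given point depends on a finite part of \<open>A\<close> only.
  Boundedness of \<open>\<phi>\<close> with constant \<open>m\<close> makes the preimages \<open>f A\<close> of the \<open>h A\<close> pairwise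
  separated by 1 in the supremum norm, and uniform continuity of the inverse makes \<open>f A\<close> the
  pointwise limit of the \<open>f B\<close> over the finite initial pieces \<open>B\<close> of \<open>A\<close>. As \<open>X\<close> is pseudocompact,
  the countably many \<open>f B\<close> with \<open>B\<close> finite map \<open>X\<close> onto a compact metric space \<open>Z\<close>,
  through which every \<open>f A\<close> factors continuously. So \<open>C(Z)\<close> would contain an uncountable
  1-separated set, contradicting its separability.
\<close>

section \<open>Compactness of metric images of pseudocompact spaces\<close>

text \<open>An infinite subset without limit points in \<open>S\<close> contains a sequence whose
  range is closed and discrete in \<open>S\<close>. Numbering its points is continuous there, and
  the Tietze extension of this numbering to \<open>S\<close> is unbounded.\<close>

lemma compact_if_continuous_imp_bounded:
  fixes S :: "'m::{metric_space,second_countable_topology} set"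
  assumes bd: "\<And>g::'m \<Rightarrow> real. continuous_on S g \<Longrightarrow> bounded (g ` S)"
  shows "compact S"
  unfolding compact_eq_Bolzano_Weierstrass
proof (intro allI impI, elim conjE, rule ccontr)
  fix T assume T: "infinite T" "T \<subseteq> S" and no_limpt: "\<not> (\<exists>x\<in>S. x islimpt T)"
  obtain t :: "nat \<Rightarrow> 'm" where t: "inj t" "range t \<subseteq> T"
    using infinite_countable_subset[OF T(1)] by blast
  have isol: "\<not> x islimpt range t" if "x \<in> S" for x
    using no_limpt t(2) that islimpt_subset by blast
  have "closedin (top_of_set S) (range t)"
    unfolding closedin_limpt using t T isol by auto
  moreover have "continuous_on (range t) (\<lambda>x. real (inv t x))"
    unfolding continuous_on_eq_continuous_within
  proof
    fix x assume "x \<in> range t"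
    then have "trivial_limit (at x within range t)"
      using isol[of x] t T by (auto simp: trivial_limit_within)
    then show "continuous (at x within range t) (\<lambda>x. real (inv t x))"
      by (simp add: continuous_trivial_limit)
  qed
  ultimately obtain g :: "'m \<Rightarrow> real" where g: "continuous_on S g"
      "\<And>x. x \<in> range t \<Longrightarrow> g x = real (inv t x)"
    using Tietze_unbounded by metis
  obtain b where b: "\<And>x. x \<in> S \<Longrightarrow> \<bar>g x\<bar> \<le> b"
    using bd[OF g(1)] by (auto simp: bounded_iff)
  obtain n where "b < real n" using reals_Archimedean2 by blast
  moreover have "g (t n) = real n" using g(2) t(1) by simp
  moreover have "t n \<in> S" using t T by auto
  ultimately show False using b[of "t n"] by auto
qed

lemma compact_image_pseudocompact:
  fixes G :: "'a \<Rightarrow> 'm::{metric_space,second_countable_topology}"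
  assumes "pseudocompact_space X" "continuous_map X euclidean G"
  shows "compact (G ` topspace X)"
proof (rule compact_if_continuous_imp_bounded)
  fix g :: "'m \<Rightarrow> real" assume g: "continuous_on (G ` topspace X) g"
  have "continuous_map X (top_of_set (G ` topspace X)) G"
    using assms(2) by (simp add: continuous_map_in_subtopology)
  then have "continuous_map X euclideanreal (g \<circ> G)"
    using g by (auto intro: continuous_map_compose)
  then show "bounded (g ` G ` topspace X)"
    using assms(1) by (auto simp: pseudocompact_space_def image_comp)
qed

section \<open>Separability of the function space of a compact metric space\<close>

text \<open>By uniform continuity, each \<open>q i\<close> is determined up to \<open>e\<close> by
  its rounded values on a fine enough finite net. Only countably many such records exist, so two of
  uncountably many indices share one.\<close>

lemma uncountable_family_close_pair:
  fixes q :: "'i \<Rightarrow> 'm::metric_space \<Rightarrow> real"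
  assumes Z: "compact Z" and q: "\<And>i. i \<in> I \<Longrightarrow> continuous_on Z (q i)"
    and I: "uncountable I" and e: "e > 0"
  obtains i j where "i \<in> I" "j \<in> I" "i \<noteq> j" "\<And>z. z \<in> Z \<Longrightarrow> \<bar>q i z - q j z\<bar> < e"
proof -
  \<comment> \<open>Three errors add up: moving from \<open>z\<close> to a net point
    \<open>w\<close> under \<open>q i\<close>, rounding at \<open>w\<close>, and moving back to
    \<open>z\<close> under \<open>q j\<close>.\<close>
  define \<epsilon> where "\<epsilon> = e / 3"
  have "\<epsilon> > 0" using e by (simp add: \<epsilon>_def)
  have "\<exists>ns. set ns \<subseteq> Z \<and> (\<forall>z\<in>Z. \<exists>w\<in>set ns. dist z w < 1 / real (Suc k))" for k
  proof -
    obtain C where "finite C" "C \<subseteq> Z" "Z \<subseteq> (\<Union>x\<in>C. ball x (1 / real (Suc k)))"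
      using seq_compact_imp_totally_bounded[of Z] Z
      by (metis compact_eq_seq_compact_metric divide_pos_pos of_nat_0_less_iff zero_less_Suc zero_less_one)
    moreover from this obtain ns where "set ns = C" using finite_list by blast
    ultimately show ?thesis by (intro exI[of _ ns]) (fastforce simp: dist_commute)
  qed
  then obtain net where net: "\<And>k. set (net k) \<subseteq> Z"
      "\<And>k z. z \<in> Z \<Longrightarrow> \<exists>w\<in>set (net k). dist z w < 1 / real (Suc k)"
    by metis
  have "\<exists>k. \<forall>z\<in>Z. \<forall>w\<in>Z. dist z w < 1 / real (Suc k) \<longrightarrow> \<bar>q i z - q i w\<bar> < \<epsilon>"
    if "i \<in> I" for i
  proof -
    have "uniformly_continuous_on Z (q i)"
      using compact_uniformly_continuous q[OF that] Z by blast
    then obtain d where "d > 0" and d: "\<And>z w. z \<in> Z \<Longrightarrow> w \<in> Z \<Longrightarrow> dist z w < d \<Longrightarrow> \<bar>q i z - q i w\<bar> < \<epsilon>"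
      using \<open>\<epsilon> > 0\<close> unfolding uniformly_continuous_on_def dist_real_def
      by (metis abs_minus_commute dist_commute)
    obtain k where "1 / real (Suc k) < d" using \<open>d > 0\<close> nat_approx_posE by blast
    then show ?thesis using d by (meson less_trans)
  qed
  then obtain k where k: "\<And>i z w. i \<in> I \<Longrightarrow> z \<in> Z \<Longrightarrow> w \<in> Z \<Longrightarrow>
      dist z w < 1 / real (Suc (k i)) \<Longrightarrow> \<bar>q i z - q i w\<bar> < \<epsilon>"
    by metis
  \<comment> \<open>The code records the mesh \<open>k i\<close> as well, so that equal codes refer
    to the same net. It is a number with a list of integers, hence of countable type.\<close>
  define code where "code i = (k i, map (\<lambda>z. \<lfloor>q i z / \<epsilon>\<rfloor>) (net (k i)))" for i
  have "\<not> inj_on code I"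
    using I countable_image_inj_on[of code I] by (metis countableI_type)
  then obtain i j where ij: "i \<in> I" "j \<in> I" "i \<noteq> j" "code i = code j"
    by (auto simp: inj_on_def)
  show thesis
  proof (rule that[OF ij(1-3)])
    fix z assume z: "z \<in> Z"
    obtain w where w: "w \<in> set (net (k i))" "dist z w < 1 / real (Suc (k i))"
      using net(2) z by blast
    have wZ: "w \<in> Z" using w net by blast
    have kij: "k i = k j" using ij by (simp add: code_def)
    then have "\<lfloor>q i w / \<epsilon>\<rfloor> = \<lfloor>q j w / \<epsilon>\<rfloor>"
      using ij(4) w(1) by (simp add: code_def)
    then have "\<bar>q i w / \<epsilon> - q j w / \<epsilon>\<bar> < 1" by linarith
    then have "\<bar>q i w - q j w\<bar> < \<epsilon>"
      using \<open>\<epsilon> > 0\<close> by (simp flip: diff_divide_distrib add: abs_divide)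
    moreover have "\<bar>q i z - q i w\<bar> < \<epsilon>" "\<bar>q j z - q j w\<bar> < \<epsilon>"
      using k[OF ij(1) z wZ] k[OF ij(2) z wZ] w kij by auto
    ultimately show "\<bar>q i z - q j z\<bar> < e" unfolding \<epsilon>_def by linarith
  qed
qed

lemma uncountable_UNIV_nat_set: "uncountable (UNIV :: nat set set)"
proof
  assume "countable (UNIV :: nat set set)"
  then have "range (from_nat_into (UNIV :: nat set set)) = Pow UNIV"
    by (simp add: range_from_nat_into)
  then show False using Cantors_theorem[of "UNIV :: nat set"] by blast
qed

section \<open>Factoring the family through a compact metric space\<close>

lemma pseudocompact_close_pair:
  fixes f :: "nat set \<Rightarrow> 'a \<Rightarrow> real"
  assumes X: "pseudocompact_space X"
    and f: "\<And>A. continuous_map X euclideanreal (f A)"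
    and lim: "\<And>A x. x \<in> topspace X \<Longrightarrow> (\<lambda>n. f (A \<inter> {..<n}) x) \<longlonglongrightarrow> f A x"
  obtains A B where "A \<noteq> B" "\<And>x. x \<in> topspace X \<Longrightarrow> \<bar>f A x - f B x\<bar> < 1"
proof -
  \<comment> \<open>\<open>set_decode\<close> enumerates the finite sets of naturals, so
    \<open>F x\<close> lists the values at \<open>x\<close> of all \<open>f B\<close> with
    \<open>B\<close> finite, as a point of a metrizable countable product.\<close>
  define F :: "'a \<Rightarrow> nat \<Rightarrow> real" where "F x i = f (set_decode i) x" for x i
  have F: "continuous_map X euclidean F"
    using f by (simp add: F_def continuous_map_componentwise_UNIV flip: euclidean_product_topology)
  define Z where "Z = F ` topspace X"
  have Z: "compact Z" unfolding Z_def by (rule compact_image_pseudocompact[OF X F])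
  \<comment> \<open>The truncations of \<open>A\<close> are finite, so \<open>F x\<close> fixes
    their values at \<open>x\<close> and, in the limit, \<open>f A x\<close>.\<close>
  have sep: "f A x = f A x'" if "x \<in> topspace X" "x' \<in> topspace X" "F x = F x'" for A x x'
  proof -
    have "f (A \<inter> {..<n}) x = f (A \<inter> {..<n}) x'" for n
      using fun_cong[OF that(3), of "set_encode (A \<inter> {..<n})"] by (simp add: F_def)
    then show ?thesis using lim[OF that(1), of A] lim[OF that(2), of A] LIMSEQ_unique by auto
  qed
  have "\<exists>q. continuous_on Z q \<and> (\<forall>x\<in>topspace X. f A x = q (F x))" for A
  proof -
    \<comment> \<open>Adjoining \<open>f A\<close> to \<open>F\<close> gives another compact image
      \<open>W\<close>. Its projection to \<open>Z\<close> is a continuous bijection by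
      \<open>sep\<close>, so the inverse is continuous and its first component is the
      factor.\<close>
    define W where "W = (\<lambda>x. (f A x, F x)) ` topspace X"
    have "continuous_map X euclidean (\<lambda>x. (f A x, F x))"
      using continuous_map_pairedI[OF f F] by simp
    then have W: "compact W" unfolding W_def by (rule compact_image_pseudocompact[OF X])
    have inj: "inj_on snd W" by (auto simp: W_def inj_on_def intro: sep)
    have snd: "snd ` W = Z" by (simp add: W_def Z_def image_comp comp_def)
    have "continuous_on W snd" by (intro continuous_intros)
    from continuous_on_inv[OF this W, of "inv_into W snd"]
    have "continuous_on (snd ` W) (inv_into W snd)" using inj by simp
    then have "continuous_on Z (inv_into W snd)" by (simp only: snd)
    then have "continuous_on Z (\<lambda>z. fst (inv_into W snd z))" by (intro continuous_intros)
    moreover have "f A x = fst (inv_into W snd (F x))" if "x \<in> topspace X" for x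
      using inv_into_f_f[OF inj, of "(f A x, F x)"] that by (auto simp: W_def)
    ultimately show ?thesis by blast
  qed
  then obtain q where q: "\<And>A. continuous_on Z (q A)"
      "\<And>A x. x \<in> topspace X \<Longrightarrow> f A x = q A (F x)"
    by metis
  obtain A B where "A \<noteq> B" "\<And>z. z \<in> Z \<Longrightarrow> \<bar>q A z - q B z\<bar> < 1"
    using uncountable_family_close_pair[of Z UNIV q 1, OF Z q(1) uncountable_UNIV_nat_set zero_less_one]
    by metis
  then show thesis using that q(2) by (auto simp: Z_def)
qed

section \<open>Bounded functions coded by sets of naturals\<close>

text \<open>For nonempty \<open>S\<close>, this is the upper envelope of the tents of height and
  radius 1 centred at the points of \<open>S\<close>.\<close>

definition bump :: "real set \<Rightarrow> real \<Rightarrow> real" where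
  "bump S r = max 0 (1 - infdist r S)"

lemma continuous_on_bump: "continuous_on UNIV (bump S)"
  unfolding bump_def by (intro continuous_intros)

lemma bump_bounds: "0 \<le> bump S r" "bump S r \<le> 1"
  by (auto simp: bump_def infdist_nonneg)

lemma bump_mem: "r \<in> S \<Longrightarrow> bump S r = 1"
  by (simp add: bump_def)

lemma bump_far:
  assumes "S \<noteq> {}" "\<And>p. p \<in> S \<Longrightarrow> 1 \<le> \<bar>r - p\<bar>"
  shows "bump S r = 0"
proof -
  have "1 \<le> infdist r S"
    using assms by (auto simp: infdist_notempty dist_real_def intro!: cINF_greatest)
  then show ?thesis by (simp add: bump_def)
qed

text \<open>A point of \<open>S\<close> near \<open>r\<close> also bounds
  \<open>infdist r T\<close>, and one at distance at least 1 contributes nothing. Applied in both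
  directions, this shows that the value at \<open>r\<close> depends only on the points within
  distance 1 of \<open>r\<close>.\<close>

lemma bump_mono_local:
  assumes "S \<noteq> {}" "\<And>p. p \<in> S \<Longrightarrow> \<bar>r - p\<bar> < 1 \<Longrightarrow> p \<in> T"
  shows "bump S r \<le> bump T r"
proof -
  have "1 - bump T r \<le> dist r p" if "p \<in> S" for p
  proof (cases "\<bar>r - p\<bar> < 1")
    case True
    then show ?thesis
      using infdist_le[of p T r] assms(2)[OF that] by (simp add: bump_def)
  next
    case False
    then show ?thesis using bump_bounds(1)[of T r] by (simp add: dist_real_def)
  qed
  then have "1 - bump T r \<le> infdist r S"
    using assms(1) by (auto simp: infdist_notempty intro!: cINF_greatest)
  then show ?thesis using bump_bounds(1)[of T r] by (auto simp: bump_def)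
qed

text \<open>Tents are placed at values of \<open>\<bar>h\<bar>\<close> more than 1 apart, so each
  vanishes at the other centres and membership in \<open>A\<close> can be read off. Only finitely
  many centres lie near a given \<open>\<bar>h y\<bar>\<close>.\<close>

lemma not_pseudocompact_family:
  assumes "\<not> pseudocompact_space Y"
  obtains v :: "nat set \<Rightarrow> 'b \<Rightarrow> real"
  where "\<And>A. continuous_map Y euclideanreal (v A)" "\<And>A y. \<bar>v A y\<bar> \<le> 1"
    "\<And>A B. A \<noteq> B \<Longrightarrow> \<exists>y\<in>topspace Y. \<bar>v A y - v B y\<bar> = 1"
    "\<And>A y. \<forall>\<^sub>F n in sequentially. v (A \<inter> {..<n}) y = v A y"
proof -
  obtain h where h: "continuous_map Y euclideanreal h" "\<not> bounded (h ` topspace Y)"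
    using assms by (auto simp: pseudocompact_space_def)
  have far: "\<exists>y\<in>topspace Y. b < \<bar>h y\<bar>" for b
    using h(2) by (auto simp: bounded_iff) (meson not_le)
  then obtain pt where pt: "\<And>b. pt b \<in> topspace Y" "\<And>b. b < \<bar>h (pt b)\<bar>" by metis
  \<comment> \<open>\<open>c 0 = 0\<close> need not be a value of \<open>\<bar>h\<bar>\<close>, so
    only the \<open>c (Suc n)\<close> serve as centres.\<close>
  define c where "c n = ((\<lambda>b. \<bar>h (pt (b + 1))\<bar>) ^^ n) 0" for n
  have c0: "c 0 = 0" and c_Suc: "\<And>n. c (Suc n) = \<bar>h (pt (c n + 1))\<bar>" by (auto simp: c_def)
  have step: "c n + 1 < c (Suc n)" for n unfolding c_Suc by (rule pt)
  have gap: "c i + 1 < c j" if "i < j" for i j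
    using that
  proof (induction j)
    case (Suc j)
    then show ?case using step[of j] by (cases "i = j") auto
  qed simp
  have grow: "real n \<le> c n" for n
  proof (induction n)
    case (Suc n) then show ?case using step[of n] by simp
  qed (simp add: c0)
  text \<open>The extra point \<open>-1\<close> keeps the set nonempty, as \<open>infdist r {} = 0\<close>.\<close>
  define S where "S A = insert (- 1) ((\<lambda>n. c (Suc n)) ` A)" for A
  define v where "v A y = bump (S A) \<bar>h y\<bar>" for A y
  have "continuous_map Y euclideanreal (v A)" for A
  proof -
    have "continuous_map euclideanreal euclideanreal (\<lambda>r. bump (S A) \<bar>r\<bar>)"
      by (simp, intro continuous_on_compose2[OF continuous_on_bump] continuous_intros) simp
    from continuous_map_compose[OF h(1) this] show ?thesis by (simp add: v_def[abs_def] comp_def)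
  qed
  moreover have "\<bar>v A y\<bar> \<le> 1" for A y using bump_bounds by (simp add: v_def)
  moreover have "\<exists>y\<in>topspace Y. \<bar>v A y - v B y\<bar> = 1" if "A \<noteq> B" for A B
  proof -
    have one: "v A (pt (c n + 1)) = (if n \<in> A then 1 else 0)" for n A
    proof (cases "n \<in> A")
      case True
      then show ?thesis by (auto simp: v_def S_def bump_mem simp flip: c_Suc)
    next
      case False
      have "1 \<le> \<bar>c (Suc n) - c (Suc k)\<bar>" if "k \<in> A" for k
        using gap[of "Suc n" "Suc k"] gap[of "Suc k" "Suc n"] that False
        by (cases n k rule: linorder_cases) auto
      moreover have "1 \<le> \<bar>c (Suc n) - (- 1)\<bar>" using grow[of "Suc n"] by simp
      ultimately have "bump (S A) (c (Suc n)) = 0"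
        by (intro bump_far) (auto simp: S_def)
      then show ?thesis using False by (simp add: v_def c_Suc)
    qed
    obtain n where "(n \<in> A) \<noteq> (n \<in> B)" using \<open>A \<noteq> B\<close> by blast
    then have "\<bar>v A (pt (c n + 1)) - v B (pt (c n + 1))\<bar> = 1" by (auto simp: one)
    then show ?thesis using pt by blast
  qed
  moreover have "\<forall>\<^sub>F n in sequentially. v (A \<inter> {..<n}) y = v A y" for A y
  proof -
    obtain N where N: "\<bar>h y\<bar> + 1 < real N" using reals_Archimedean2 by blast
    have "v (A \<inter> {..<n}) y = v A y" if "N \<le> n" for n
    proof -
      \<comment> \<open>Since \<open>Suc k\<close> \<le> \<open>c (Suc k)\<close>, truncation at
        \<open>n\<close> keeps every centre that can influence the value at
        \<open>y\<close>.\<close>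
      have "k < n" if "\<bar>\<bar>h y\<bar> - c (Suc k)\<bar> < 1" for k
        using grow[of "Suc k"] N that \<open>N \<le> n\<close> by linarith
      then show ?thesis
        unfolding v_def by (intro antisym bump_mono_local) (auto simp: S_def)
    qed
    then show ?thesis by (auto simp: eventually_sequentially)
  qed
  ultimately show thesis by (rule that)
qed

section \<open>Pointwise estimates from uniform continuity and boundedness\<close>

lemma uniformly_continuous_p_at:
  assumes "uniformly_continuous_p S D T E \<phi>" "y \<in> T" "e > 0"
  obtains K \<delta> where "finite K" "K \<subseteq> S" "\<delta> > 0"
    "\<And>f g. f \<in> D \<Longrightarrow> g \<in> D \<Longrightarrow> \<forall>x\<in>K. \<bar>f x - g x\<bar> < \<delta> \<Longrightarrow> \<bar>\<phi> f y - \<phi> g y\<bar> < e"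
proof -
  have "\<forall>\<^sub>F p in pointwise_uniformity T E. \<bar>fst p y - snd p y\<bar> < e"
    unfolding eventually_pointwise_uniformity
    using assms(2,3) by (intro exI[of _ "{y}"] exI[of _ e]) auto
  then have "\<forall>\<^sub>F p in pointwise_uniformity S D. \<bar>\<phi> (fst p) y - \<phi> (snd p) y\<bar> < e"
    using assms(1) by (auto simp: uniformly_continuous_p_def filterlim_iff case_prod_unfold)
  then show thesis
    unfolding eventually_pointwise_uniformity using that by fastforce
qed

text \<open>Closeness on all of \<open>S\<close> implies closeness on whichever finite
  \<open>K\<close> belongs to \<open>y\<close>, so only the common constant \<open>m\<close>
  survives.\<close>

lemma bounded_map_sup_bound:
  assumes "bounded_map S D T \<phi>"
  obtains m :: nat where "\<And>y f g. y \<in> T \<Longrightarrow> f \<in> D \<Longrightarrow> g \<in> D \<Longrightarrow>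
    \<forall>x\<in>S. \<bar>f x - g x\<bar> < 1 \<Longrightarrow> \<bar>\<phi> f y - \<phi> g y\<bar> \<le> real m"
proof -
  obtain m :: nat where m: "\<And>y. y \<in> T \<Longrightarrow> \<exists>K. finite K \<and> K \<subseteq> S \<and> a_map D \<phi> y K \<le> of_nat m"
    using assms by (auto simp: bounded_map_def)
  show thesis
  proof (rule that)
    fix y f g assume y: "y \<in> T" and fg: "f \<in> D" "g \<in> D" "\<forall>x\<in>S. \<bar>f x - g x\<bar> < 1"
    obtain K where K: "K \<subseteq> S" "a_map D \<phi> y K \<le> of_nat m" using m[OF y] by blast
    have "ennreal \<bar>\<phi> f y - \<phi> g y\<bar> \<le> a_map D \<phi> y K"
      unfolding a_map_def using fg K(1) by (intro SUP_upper2[of "(f, g)"]) auto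
    also have "\<dots> \<le> ennreal (real m)" using K(2) by (simp add: ennreal_of_nat_eq_real_of_nat)
    finally show "\<bar>\<phi> f y - \<phi> g y\<bar> \<le> real m" by (simp add: ennreal_le_iff)
  qed
qed

section \<open>Contradiction from two uniformly close preimages\<close>

theorem theorem1p1:
  fixes X :: "'a topology" and Y :: "'b topology"
    and DY :: "('b \<Rightarrow> real) set"
    and \<phi> :: "('a \<Rightarrow> real) \<Rightarrow> ('b \<Rightarrow> real)"
  assumes "tychonoff_space X" and "tychonoff_space Y"
    and "DY = Cp Y \<or> DY = Cp_star Y"
    and "uniform_homeomorphism_p (topspace X) (Cp_star X) (topspace Y) DY \<phi>"
    and "bounded_map (topspace X) (Cp_star X) (topspace Y) \<phi>"
    and "pseudocompact_space X"
  shows "pseudocompact_space Y"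
proof (rule ccontr)
  assume "\<not> pseudocompact_space Y"
  then obtain v :: "nat set \<Rightarrow> 'b \<Rightarrow> real" where
    v: "\<And>A. continuous_map Y euclideanreal (v A)" "\<And>A y. \<bar>v A y\<bar> \<le> 1"
      "\<And>A B. A \<noteq> B \<Longrightarrow> \<exists>y\<in>topspace Y. \<bar>v A y - v B y\<bar> = 1"
    and v_lim: "\<And>A y. \<forall>\<^sub>F n in sequentially. v (A \<inter> {..<n}) y = v A y"
    using not_pseudocompact_family by blast
  obtain m :: nat where m: "\<And>y f g. y \<in> topspace Y \<Longrightarrow> f \<in> Cp_star X \<Longrightarrow> g \<in> Cp_star X \<Longrightarrow>
      \<forall>x\<in>topspace X. \<bar>f x - g x\<bar> < 1 \<Longrightarrow> \<bar>\<phi> f y - \<phi> g y\<bar> \<le> real m"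
    using bounded_map_sup_bound[OF assms(5)] by blast
  \<comment> \<open>The factor \<open>real m + 1\<close> makes distinct members differ by more than
    \<open>m\<close> at some point.\<close>
  define h where "h A = restrict (\<lambda>y. (real m + 1) * v A y) (topspace Y)" for A
  have "h A \<in> Cp_star Y" for A
  proof -
    have "continuous_map Y euclideanreal (\<lambda>y. (real m + 1) * v A y)"
      by (intro continuous_intros v)
    then have "continuous_map Y euclideanreal (h A)"
      by (rule continuous_map_eq) (simp add: h_def)
    moreover have "bounded (h A ` topspace Y)"
      unfolding bounded_iff
      by (rule exI[of _ "real m + 1"])
         (use v(2) in \<open>auto simp: h_def abs_mult intro!: mult_left_le\<close>)
    ultimately show ?thesis by (simp add: Cp_star_def Cp_def h_def)
  qed
  \<comment> \<open>The bounded functions lie in \<open>DY\<close> under either choice of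
    it.\<close>
  then have h: "h A \<in> DY" for A using assms(3) by (auto simp: Cp_star_def)
  have bij: "bij_betw \<phi> (Cp_star X) DY"
    and uc: "uniformly_continuous_p (topspace Y) DY (topspace X) (Cp_star X) (inv_into (Cp_star X) \<phi>)"
    using assms(4) by (auto simp: uniform_homeomorphism_p_def)
  define f where "f A = inv_into (Cp_star X) \<phi> (h A)" for A
  have f: "f A \<in> Cp_star X" "\<phi> (f A) = h A" for A
    using h[of A] bij inv_into_into[of "h A" \<phi> "Cp_star X"] f_inv_into_f[of "h A" \<phi> "Cp_star X"]
    by (simp_all add: f_def bij_betw_def)
  have f_lim: "(\<lambda>n. f (A \<inter> {..<n}) x) \<longlonglongrightarrow> f A x" if x: "x \<in> topspace X" for A x
  proof (rule tendstoI)
    fix e :: real assume "e > 0"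
    from uniformly_continuous_p_at[OF uc x this] obtain K \<delta> where
      K: "finite K" "K \<subseteq> topspace Y" "\<delta> > 0"
        "\<And>f g. f \<in> DY \<Longrightarrow> g \<in> DY \<Longrightarrow> \<forall>x\<in>K. \<bar>f x - g x\<bar> < \<delta> \<Longrightarrow>
          \<bar>inv_into (Cp_star X) \<phi> f x - inv_into (Cp_star X) \<phi> g x\<bar> < e"
      by metis
    \<comment> \<open>As \<open>K\<close> is finite, the truncations eventually agree with
      \<open>v A\<close> on all of \<open>K\<close>, so the differences there are 0.\<close>
    have "\<forall>\<^sub>F n in sequentially. \<forall>y\<in>K. v (A \<inter> {..<n}) y = v A y"
      using K(1) v_lim by (simp add: eventually_ball_finite)
    then show "\<forall>\<^sub>F n in sequentially. dist (f (A \<inter> {..<n}) x) (f A x) < e"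
    proof eventually_elim
      case (elim n)
      then have "\<forall>y\<in>K. \<bar>h (A \<inter> {..<n}) y - h A y\<bar> < \<delta>" using K(2,3) by (auto simp: h_def)
      then show ?case using K(4)[OF h h] by (simp add: f_def dist_real_def)
    qed
  qed
  have f_cont: "continuous_map X euclideanreal (f A)" for A
    using f(1)[of A] by (simp add: Cp_star_def Cp_def)
  obtain A B where AB: "A \<noteq> B" "\<And>x. x \<in> topspace X \<Longrightarrow> \<bar>f A x - f B x\<bar> < 1"
    using pseudocompact_close_pair[OF assms(6) f_cont f_lim] by metis
  obtain y where y: "y \<in> topspace Y" "\<bar>v A y - v B y\<bar> = 1" using v(3)[OF AB(1)] by blast
  have "\<bar>h A y - h B y\<bar> \<le> real m"
    using m[OF y(1) f(1) f(1), of A B] AB(2) f(2) by auto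
  moreover have "\<bar>h A y - h B y\<bar> = real m + 1"
    using y by (simp add: h_def abs_mult flip: right_diff_distrib)
  ultimately show False by simp
qed

end
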